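(* Let $d\in\{2,3\}$, let $\Omega\subset\mathbb{R}^d$ be a polygonal domain, and let $\{\mathcal{T}_h\}_h$ be a quasi-uniform family of triangulations of $\Omega$ into simplices, with mesh size $h$. Then there exist constants $0<c\le C$, independent of $h$, such that for every $h$ and every continuous vector field $u:\Omega\to\mathbb{R}^d$ that is piecewise linear with respect to $\mathcal{T}_h$, the associated scalar function $u_G$ (defined in the context) satisfies $$c\,\|\varepsilon(u)\|_{0,\Omega}\;\le\;\|\nabla u_G\|_{0,\Omega}\;\le\;C\,\|\varepsilon(u)\|_{0,\Omega}.$$
   Context: Let $\{\phi_i\}_{i=1}^n$ be the standard nodal (hat) basis of the space $V_1$ of continuous piecewise linear functions on $\mathcal{T}_h$, with $\phi_i$ associated with the mesh vertex $x_i=(x_{1,i},\dots,x_{d,i})$. Set $\psi_{k,i}(x)=\frac{x_k-x_{k,i}}{h}$, where $x_k$ is the $k$-th coordinate of $x$. For $u=(u_k)_{k=1}^d\in V_1^d$ with $u_k=\sum_{i=1}^n\alpha_{k,i}\phi_i$, the associated GFEM function is $$u_G:=\sum_{k=1}^d\sum_{i=1}^n\alpha_{k,i}\,\psi_{k,i}\,\phi_i .$$ The strain tensor is $\varepsilon_{ij}(u)=\frac12(\partial_j u_i+\partial_i u_j)$. $\|\cdot\|_{0,\Omega}$ is the $L_2(\Omega)$ norm (for matrix-valued functions based on the Frobenius norm, for vector-valued functions on the Euclidean norm). Quasi-uniform family means: the simplices are uniformly shape regular, and all simplices of $\mathcal{T}_h$ have diameter comparable to $h$, with constants independent of $h$.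 *)

theory Defs
  imports "HOL-Analysis.Analysis"
begin

text \<open>Crack domains are admitted: the open set need not be the interior of its closure.\<close>

definition polygonal_domain :: "(real^'d) set \<Rightarrow> bool" where
  "polygonal_domain \<Omega> \<longleftrightarrow>
     open \<Omega> \<and> connected \<Omega> \<and> bounded \<Omega> \<and> \<Omega> \<noteq> {} \<and>
     (\<exists>\<F>. finite \<F> \<and> (\<forall>F\<in>\<F>. polytope F \<and> aff_dim F = int CARD('d) - 1) \<and> frontier \<Omega> = \<Union>\<F>)"

text \<open>The library notion \<^const>\<open>triangulation\<close> supplies finiteness and conformity (any two
  simplices meet in a common, possibly empty, face). It allows simplices of any dimension.\<close>

definition triangulation_of :: "(real^'d) set \<Rightarrow> (real^'d) set set \<Rightarrow> bool" where
  "triangulation_of \<Omega> \<T> \<longleftrightarrow>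
     triangulation \<T> \<and> (\<forall>K\<in>\<T>. int CARD('d) simplex K) \<and> \<Union>\<T> = closure \<Omega>"

text \<open>The index \<open>h\<close> need not equal the largest diameter; it is only comparable to all diameters.\<close>

definition quasi_uniform :: "real set \<Rightarrow> (real \<Rightarrow> (real^'d) set set) \<Rightarrow> bool" where
  "quasi_uniform H \<T> \<longleftrightarrow>
     (\<exists>\<kappa>>0. \<forall>h\<in>H. \<forall>K\<in>\<T> h. \<exists>z r. \<kappa> * diameter K \<le> r \<and> ball z r \<subseteq> K) \<and>
     (\<exists>a>0. \<exists>b>0. \<forall>h\<in>H. \<forall>K\<in>\<T> h. a * h \<le> diameter K \<and> diameter K \<le> b * h)"

definition mesh_vertices :: "(real^'d) set set \<Rightarrow> (real^'d) set" where
  "mesh_vertices \<T> = {v. \<exists>K\<in>\<T>. v extreme_point_of K}"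

text \<open>The space \<open>V\<^sub>1\<close>. Its elements are functions on the closed set \<^term>\<open>\<Union>\<T>\<close>; the values elsewhere
  are unconstrained and never used.\<close>

definition V1 :: "(real^'d) set set \<Rightarrow> (real^'d \<Rightarrow> real) set" where
  "V1 \<T> = {f. continuous_on (\<Union>\<T>) f \<and> (\<forall>K\<in>\<T>. \<exists>a b. \<forall>x\<in>K. f x = a \<bullet> x + b)}"

definition V1_vec :: "(real^'d) set set \<Rightarrow> (real^'d \<Rightarrow> real^'d) set" where
  "V1_vec \<T> = {u. \<forall>k. (\<lambda>x. u x $ k) \<in> V1 \<T>}"

text \<open>Both choices below are unique where it matters: on a conforming mesh the hat function is
  determined on \<^term>\<open>\<Union>\<T>\<close>, and the coefficients are determined on the vertices.\<close>

definition hat :: "(real^'d) set set \<Rightarrow> real^'d \<Rightarrow> real^'d \<Rightarrow> real" where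
  "hat \<T> v = (SOME \<phi>. \<phi> \<in> V1 \<T> \<and> (\<forall>w\<in>mesh_vertices \<T>. \<phi> w = (if w = v then 1 else 0)))"

definition nodal_coeff :: "(real^'d) set set \<Rightarrow> (real^'d \<Rightarrow> real) \<Rightarrow> real^'d \<Rightarrow> real" where
  "nodal_coeff \<T> f =
     (SOME \<alpha>. \<forall>x\<in>\<Union>\<T>. f x = (\<Sum>v\<in>mesh_vertices \<T>. \<alpha> v * hat \<T> v x))"

definition gfem_enrichment :: "real \<Rightarrow> 'd \<Rightarrow> real^'d \<Rightarrow> real^'d \<Rightarrow> real" where
  "gfem_enrichment h k v x = (x $ k - v $ k) / h"

definition gfem_function ::
  "(real^'d) set set \<Rightarrow> real \<Rightarrow> (real^'d \<Rightarrow> real^'d) \<Rightarrow> real^'d \<Rightarrow> real" where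
  "gfem_function \<T> h u x =
     (\<Sum>k\<in>UNIV. \<Sum>v\<in>mesh_vertices \<T>.
        nodal_coeff \<T> (\<lambda>y. u y $ k) v * gfem_enrichment h k v x * hat \<T> v x)"

text \<open>Classical partial derivatives. For continuous functions that are polynomial on each simplex
  they agree almost everywhere with the weak ones: the only exceptional points lie on the
  boundaries of the simplices, a null set.\<close>

definition partial_deriv :: "'d \<Rightarrow> (real^'d \<Rightarrow> real) \<Rightarrow> real^'d \<Rightarrow> real" where
  "partial_deriv j f x = deriv (\<lambda>t. f (x + t *\<^sub>R axis j 1)) 0"

definition grad :: "(real^'d \<Rightarrow> real) \<Rightarrow> real^'d \<Rightarrow> real^'d" where
  "grad f x = (\<chi> j. partial_deriv j f x)"

definition strain :: "(real^'d \<Rightarrow> real^'d) \<Rightarrow> real^'d \<Rightarrow> real^'d^'d" where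
  "strain u x =
     (\<chi> i j. (partial_deriv j (\<lambda>y. u y $ i) x + partial_deriv i (\<lambda>y. u y $ j) x) / 2)"

text \<open>On \<^typ>\<open>real^'d^'d\<close> the library norm is the Frobenius norm. The complete measure
  \<^const>\<open>lebesgue\<close> makes the values on the null set above harmless for measurability.\<close>

definition L2_norm :: "(real^'d) set \<Rightarrow> (real^'d \<Rightarrow> 'b::real_normed_vector) \<Rightarrow> real" where
  "L2_norm \<Omega> f = sqrt (LINT x:\<Omega>|lebesgue. (norm (f x))\<^sup>2)"

end

theory Submission
  imports Defs
begin

text \<open>The equivalence holds on every simplex separately, with the strain as the only quantity that
  enters. On a simplex \<open>K\<close> let \<open>u(x) = Ax + \<beta>\<close> and let \<open>E\<close> be the symmetric part of \<open>A\<close>, so that \<open>E\<close>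
  is the strain. Since the hat functions reproduce affine functions, \<open>h u\<^sub>G\<close> equals on \<open>K\<close> the
  interpolation error \<open>Ex \<bullet> x - I\<^sub>K(Ex \<bullet> x)\<close> of the quadratic form of \<open>E\<close>, where \<open>I\<^sub>K\<close> is nodal
  interpolation (\<open>gfem_function_on_simplex\<close>). Hence \<open>h \<nabla>u\<^sub>G = 2Ex - g\<close> with the constant gradient \<open>g\<close>
  of the interpolant (\<open>strain_and_gfem_gradient_on_simplex\<close>).

  The upper bound is pointwise. For vertices \<open>p\<close>, \<open>q\<close> the interpolation conditions give
  \<open>(2Ex - g) \<bullet> (p - q) = E(p - q) \<bullet> (2x - p - q)\<close>, which is at most \<open>2\<bar>E\<bar> diam(K)\<^sup>2\<close>. A ball of
  radius proportional to the diameter lies in \<open>K\<close>, so edge differences control the whole vector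
  (\<open>interpolation_error_gradient_le\<close>). Division by \<open>h\<close>, which is comparable to the diameter, leaves a
  constant multiple of \<open>\<bar>E\<bar>\<close>.

  For the lower bound, differences eliminate \<open>g\<close>: an affine field with derivative \<open>2E\<close> changes by \<open>2rEe\<close> under
  translation by \<open>re\<close>, so it cannot be small on most of the inball of radius \<open>r\<close>
  (\<open>affine_map_square_integral_ge\<close>), and the inball fills a fixed fraction of \<open>K\<close>
  (\<open>measure_le_by_inball\<close>). Summation over the simplices gives the theorem, because overlaps of
  simplices and the frontier of the domain are null sets (\<open>L2_norm_elementwise\<close>).\<close>

section \<open>Affine functions on simplices\<close>

lemma affine_functions_eq_on_convex_hull:
  fixes a :: "'a::real_inner"
  assumes "\<And>v. v \<in> C \<Longrightarrow> a \<bullet> v + b = a' \<bullet> v + b'" and "x \<in> convex hull C"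
  shows "a \<bullet> x + b = a' \<bullet> x + b'"
proof -
  have "convex hull C \<subseteq> {x. (a - a') \<bullet> x = b' - b}"
  proof (rule hull_minimal)
    show "C \<subseteq> {x. (a - a') \<bullet> x = b' - b}"
      using assms(1) by (auto simp: inner_diff_left algebra_simps)
  qed (rule convex_hyperplane)
  with assms(2) show ?thesis by (auto simp: inner_diff_left algebra_simps)
qed

lemma affine_functions_eq_on_convex:
  fixes a :: "'a::euclidean_space"
  assumes "compact K" "convex K"
    and "\<And>v. v extreme_point_of K \<Longrightarrow> a \<bullet> v + b = a' \<bullet> v + b'" and "x \<in> K"
  shows "a \<bullet> x + b = a' \<bullet> x + b'"
  using affine_functions_eq_on_convex_hull[of "{v. v extreme_point_of K}" a b a' b' x]
    Krein_Milman_Minkowski[OF assms(1,2)] assms(3,4) by auto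

lemma affine_interpolation:
  fixes C :: "'a::euclidean_space set"
  assumes "\<not> affine_dependent C"
  shows "\<exists>a b. \<forall>v\<in>C. a \<bullet> v + b = g v"
proof (cases "C = {}")
  case False
  then obtain v0 where v0: "v0 \<in> C" by blast
  have "independent ((\<lambda>x. - v0 + x) ` (C - {v0}))"
    using assms affine_dependent_iff_dependent2[OF v0] by blast
  then obtain L where L: "linear L"
    "\<forall>y\<in>(\<lambda>x. - v0 + x) ` (C - {v0}). L y = g (v0 + y) - g v0"
    using linear_independent_extend[of _ "\<lambda>y. g (v0 + y) - g v0"] by blast
  define a where "a = adjoint L 1"
  have La: "L y = a \<bullet> y" for y
    using adjoint_works[OF L(1), of y 1] by (simp add: a_def inner_commute)
  have "a \<bullet> v + (g v0 - a \<bullet> v0) = g v" if "v \<in> C" for v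
  proof (cases "v = v0")
    case False
    then have "L (- v0 + v) = g v - g v0"
      using L(2) that by force
    then show ?thesis by (simp add: La inner_diff_right)
  qed simp
  then show ?thesis by blast
qed simp

lemma simplex_affine_interpolation:
  fixes K :: "'a::euclidean_space set"
  assumes "n simplex K"
  obtains a b where "\<And>v. v extreme_point_of K \<Longrightarrow> a \<bullet> v + b = g v"
proof -
  obtain C where "\<not> affine_dependent C" "K = convex hull C"
    using assms by (auto simp: simplex_def)
  with affine_interpolation[of C g] show ?thesis
    by (metis extreme_point_of_convex_hull that)
qed

section \<open>Nodal bases on a conforming mesh\<close>

lemma triangulation_simplexD:
  assumes "triangulation \<T>" "K \<in> \<T>"
  shows "\<exists>n. n simplex K" and "compact K" and "convex K" and "polytope K"
proof -
  show "\<exists>n. n simplex K" using assms by (simp add: triangulation_def)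
  then show "polytope K" using simplex_imp_polytope by blast
  then show "compact K" "convex K" by (simp_all add: polytope_imp_compact polytope_imp_convex)
qed

lemma triangulation_faceD:
  assumes "triangulation \<T>" "K \<in> \<T>" "K' \<in> \<T>"
  shows "K \<inter> K' face_of K" and "K \<inter> K' face_of K'"
proof -
  have "K \<inter> K' face_of K" "K' \<inter> K face_of K'"
    using assms by (auto simp: triangulation_def)
  then show "K \<inter> K' face_of K" "K \<inter> K' face_of K'"
    by (simp_all only: Int_commute[of K' K])
qed

lemma finite_mesh_vertices:
  assumes "triangulation \<T>"
  shows "finite (mesh_vertices \<T>)"
proof -
  have "mesh_vertices \<T> = (\<Union>K\<in>\<T>. {v. v extreme_point_of K})"
    by (auto simp: mesh_vertices_def)
  moreover have "finite {v. v extreme_point_of K}" if "K \<in> \<T>" for K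
    by (intro finite_polyhedron_extreme_points polytope_imp_polyhedron
        triangulation_simplexD[OF assms that])
  ultimately show ?thesis using assms by (simp add: triangulation_def)
qed

text \<open>Conformity is what makes piecewise interpolation continuous: two simplices meet in a common
  face, this face is the convex hull of its vertices, and these are vertices of both simplices. Two
  local affine interpolants of the same nodal values therefore agree on the intersection.\<close>

lemma V1_interpolation:
  assumes "triangulation \<T>"
  obtains \<phi> where "\<phi> \<in> V1 \<T>" and "\<And>v. v \<in> mesh_vertices \<T> \<Longrightarrow> \<phi> v = g v"
proof -
  have "\<exists>a b. \<forall>v. v extreme_point_of K \<longrightarrow> a \<bullet> v + b = g v" if "K \<in> \<T>" for K
    using triangulation_simplexD(1)[OF assms that] simplex_affine_interpolation by metis
  then obtain a b where ab:
    "\<And>K v. K \<in> \<T> \<Longrightarrow> v extreme_point_of K \<Longrightarrow> a K \<bullet> v + b K = g v"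
    by metis
  define \<phi> where "\<phi> x = (let K = SOME K. K \<in> \<T> \<and> x \<in> K in a K \<bullet> x + b K)" for x
  have agree: "a K \<bullet> x + b K = a K' \<bullet> x + b K'"
    if "K \<in> \<T>" "K' \<in> \<T>" "x \<in> K" "x \<in> K'" for K K' x
  proof -
    have face: "K \<inter> K' face_of K" "K \<inter> K' face_of K'"
      using triangulation_faceD[OF assms] that by blast+
    show ?thesis
    proof (rule affine_functions_eq_on_convex)
      show "compact (K \<inter> K')" "convex (K \<inter> K')"
        using triangulation_simplexD[OF assms] that by (simp_all add: compact_Int convex_Int)
      show "x \<in> K \<inter> K'" using that by simp
      fix v assume "v extreme_point_of K \<inter> K'"
      then show "a K \<bullet> v + b K = a K' \<bullet> v + b K'"
        using ab that face extreme_point_of_face by metis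
    qed
  qed
  have \<phi>: "\<phi> x = a K \<bullet> x + b K" if "K \<in> \<T>" "x \<in> K" for K x
  proof -
    have "(SOME K. K \<in> \<T> \<and> x \<in> K) \<in> \<T> \<and> x \<in> (SOME K. K \<in> \<T> \<and> x \<in> K)"
      by (rule someI) (use that in blast)
    then show ?thesis
      unfolding \<phi>_def Let_def using agree[OF _ that(1) _ that(2)] by blast
  qed
  have "continuous_on (\<Union>K\<in>\<T>. K) \<phi>"
  proof (rule continuous_on_closed_Union)
    show "finite \<T>" using assms by (simp add: triangulation_def)
    fix K assume K: "K \<in> \<T>"
    show "closed K" by (intro compact_imp_closed triangulation_simplexD[OF assms K])
    have "continuous_on K (\<lambda>x. a K \<bullet> x + b K)" by (intro continuous_intros)
    then show "continuous_on K \<phi>" by (rule continuous_on_eq) (metis \<phi> K)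
  qed
  then have "\<phi> \<in> V1 \<T>" using \<phi> by (fastforce simp: V1_def)
  moreover have "\<phi> v = g v" if "v \<in> mesh_vertices \<T>" for v
    using that ab \<phi> by (auto simp: mesh_vertices_def extreme_point_of_def)
  ultimately show ?thesis using that by blast
qed

lemma
  assumes "triangulation \<T>"
  shows hat_in_V1: "hat \<T> v \<in> V1 \<T>"
    and hat_at_vertex: "w \<in> mesh_vertices \<T> \<Longrightarrow> hat \<T> v w = (if w = v then 1 else 0)"
proof -
  let ?P = "\<lambda>\<phi>. \<phi> \<in> V1 \<T> \<and> (\<forall>w\<in>mesh_vertices \<T>. \<phi> w = (if w = v then 1 else 0))"
  obtain \<phi> where "?P \<phi>"
    by (rule V1_interpolation[OF assms, of "\<lambda>w. if w = v then 1 else 0"]) blast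
  then have "?P (SOME \<phi>. ?P \<phi>)" by (rule someI[of ?P])
  then have "?P (hat \<T> v)" unfolding hat_def .
  then show "hat \<T> v \<in> V1 \<T>"
    "w \<in> mesh_vertices \<T> \<Longrightarrow> hat \<T> v w = (if w = v then 1 else 0)" by blast+
qed

lemma V1_linear_combination:
  assumes "finite I" "\<And>i. i \<in> I \<Longrightarrow> f i \<in> V1 \<T>"
  shows "(\<lambda>x. \<Sum>i\<in>I. c i * f i x) \<in> V1 \<T>"
proof -
  have "\<exists>a b. \<forall>x\<in>K. (\<Sum>i\<in>I. c i * f i x) = a \<bullet> x + b" if "K \<in> \<T>" for K
  proof -
    have "\<exists>a b. \<forall>x\<in>K. f i x = a \<bullet> x + b" if "i \<in> I" for i
      using assms(2)[OF that] \<open>K \<in> \<T>\<close> by (auto simp: V1_def)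
    then obtain a b where ab: "\<And>i x. i \<in> I \<Longrightarrow> x \<in> K \<Longrightarrow> f i x = a i \<bullet> x + b i"
      by metis
    have "(\<Sum>i\<in>I. c i * f i x) = (\<Sum>i\<in>I. c i *\<^sub>R a i) \<bullet> x + (\<Sum>i\<in>I. c i * b i)" if "x \<in> K" for x
      using that by (simp add: ab inner_sum_left sum.distrib algebra_simps cong: sum.cong)
    then show ?thesis by blast
  qed
  moreover have "continuous_on (\<Union>\<T>) (\<lambda>x. \<Sum>i\<in>I. c i * f i x)"
    using assms(2) by (intro continuous_intros) (auto simp: V1_def)
  ultimately show ?thesis by (simp add: V1_def)
qed

lemma nodal_sum_at_vertex:
  assumes "triangulation \<T>" "w \<in> mesh_vertices \<T>"
  shows "(\<Sum>v\<in>mesh_vertices \<T>. G v * hat \<T> v w) = G w"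
proof -
  have "(\<Sum>v\<in>mesh_vertices \<T>. G v * hat \<T> v w) = (\<Sum>v\<in>mesh_vertices \<T>. if w = v then G v else 0)"
    by (rule sum.cong) (use assms in \<open>auto simp: hat_at_vertex\<close>)
  also have "\<dots> = G w" using assms(2) by (simp add: finite_mesh_vertices[OF assms(1)])
  finally show ?thesis .
qed

text \<open>The nodal interpolant sees, on a simplex, only the values at the vertices of that simplex. With
  \<open>G = 1\<close> and \<open>G\<close> linear this contains the partition of unity and the barycentric identity, so
  it is the only property of the hat functions needed to compute the associated GFEM function.\<close>

lemma nodal_sum_on_simplex:
  assumes T: "triangulation \<T>" and K: "K \<in> \<T>" "x \<in> K"
    and G: "\<And>v. v extreme_point_of K \<Longrightarrow> G v = a \<bullet> v + b"
  shows "(\<Sum>v\<in>mesh_vertices \<T>. G v * hat \<T> v x) = a \<bullet> x + b"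
proof -
  have "(\<lambda>x. \<Sum>v\<in>mesh_vertices \<T>. G v * hat \<T> v x) \<in> V1 \<T>"
    by (rule V1_linear_combination) (use T in \<open>auto intro: finite_mesh_vertices hat_in_V1\<close>)
  then obtain a' b' where ab:
    "\<And>x. x \<in> K \<Longrightarrow> (\<Sum>v\<in>mesh_vertices \<T>. G v * hat \<T> v x) = a' \<bullet> x + b'"
    using K by (auto simp: V1_def)
  have "a' \<bullet> x + b' = a \<bullet> x + b"
  proof (rule affine_functions_eq_on_convex[OF _ _ _ K(2)])
    show "compact K" "convex K" by (rule triangulation_simplexD[OF T K(1)])+
    fix v assume v: "v extreme_point_of K"
    then have "v \<in> K" "v \<in> mesh_vertices \<T>"
      using K by (auto simp: extreme_point_of_def mesh_vertices_def)
    then show "a' \<bullet> v + b' = a \<bullet> v + b"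
      using ab[OF \<open>v \<in> K\<close>] nodal_sum_at_vertex[OF T \<open>v \<in> mesh_vertices \<T>\<close>, of G] G[OF v] by simp
  qed
  then show ?thesis using ab K by simp
qed

lemma nodal_coeff_eq:
  assumes T: "triangulation \<T>" and f: "f \<in> V1 \<T>" and v: "v \<in> mesh_vertices \<T>"
  shows "nodal_coeff \<T> f v = f v"
proof -
  have "f x = (\<Sum>v\<in>mesh_vertices \<T>. f v * hat \<T> v x)" if "x \<in> \<Union>\<T>" for x
  proof -
    obtain K where K: "K \<in> \<T>" "x \<in> K" using \<open>x \<in> \<Union>\<T>\<close> by blast
    then obtain a b where ab: "\<And>y. y \<in> K \<Longrightarrow> f y = a \<bullet> y + b"
      using f by (auto simp: V1_def)
    then have "f w = a \<bullet> w + b" if "w extreme_point_of K" for w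
      using that by (auto simp: extreme_point_of_def)
    then show ?thesis using nodal_sum_on_simplex[OF T K, of f a b] ab[OF K(2)] by simp
  qed
  then have "\<exists>\<alpha>. \<forall>x\<in>\<Union>\<T>. f x = (\<Sum>v\<in>mesh_vertices \<T>. \<alpha> v * hat \<T> v x)"
    by (intro exI[of _ f]) simp
  from someI_ex[OF this]
  have "\<forall>x\<in>\<Union>\<T>. f x = (\<Sum>v\<in>mesh_vertices \<T>. nodal_coeff \<T> f v * hat \<T> v x)"
    by (simp only: nodal_coeff_def)
  moreover have "v \<in> \<Union>\<T>" using v by (auto simp: mesh_vertices_def extreme_point_of_def)
  ultimately have "f v = (\<Sum>w\<in>mesh_vertices \<T>. nodal_coeff \<T> f w * hat \<T> w v)" by blast
  then show ?thesis using nodal_sum_at_vertex[OF T v] by simp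
qed

section \<open>The GFEM function on one simplex\<close>

lemma V1_vec_on_simplex:
  fixes u :: "real^'d \<Rightarrow> real^'d"
  assumes "u \<in> V1_vec \<T>" "K \<in> \<T>"
  obtains A \<beta> where "\<And>x. x \<in> K \<Longrightarrow> u x = A *v x + \<beta>"
proof -
  have "\<exists>a b. \<forall>x\<in>K. u x $ k = a \<bullet> x + b" for k
    using assms by (auto simp: V1_vec_def V1_def)
  then obtain a b where ab: "\<And>k x. x \<in> K \<Longrightarrow> u x $ k = a k \<bullet> x + b k" by metis
  show ?thesis
    by (rule that[of "\<chi> k. a k" "\<chi> k. b k"]) (simp add: vec_eq_iff ab matrix_vector_mul_component)
qed

lemma gfem_function_eq_sum:
  fixes u :: "real^'d \<Rightarrow> real^'d"
  assumes "triangulation \<T>" "u \<in> V1_vec \<T>"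
  shows "gfem_function \<T> h u x = (\<Sum>v\<in>mesh_vertices \<T>. (u v \<bullet> (x - v)) * hat \<T> v x) / h"
proof -
  have "gfem_function \<T> h u x =
    (\<Sum>k\<in>UNIV. \<Sum>v\<in>mesh_vertices \<T>. u v $ k * ((x - v) $ k) * hat \<T> v x / h)"
    unfolding gfem_function_def gfem_enrichment_def
    by (intro sum.cong refl) (use assms in \<open>simp add: nodal_coeff_eq V1_vec_def\<close>)
  also have "\<dots> = (\<Sum>v\<in>mesh_vertices \<T>. \<Sum>k\<in>UNIV. u v $ k * ((x - v) $ k) * hat \<T> v x / h)"
    by (rule sum.swap)
  also have "\<dots> = (\<Sum>v\<in>mesh_vertices \<T>. (u v \<bullet> (x - v)) * hat \<T> v x) / h"
    by (simp add: inner_vec_def sum_distrib_right sum_divide_distrib)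
  finally show ?thesis .
qed

text \<open>For fixed \<open>x\<close>, the product \<open>u(v) \<bullet> (x - v)\<close> is affine in \<open>v\<close> except for the term \<open>Av \<bullet> v\<close>. Hence
  the GFEM function is, up to the factor \<open>1/h\<close>, the interpolation error of the quadratic form
  \<open>Ax \<bullet> x\<close>; the translation \<open>\<beta>\<close> cancels.\<close>

lemma gfem_function_on_simplex:
  fixes u :: "real^'d \<Rightarrow> real^'d"
  assumes T: "triangulation \<T>" and u: "u \<in> V1_vec \<T>" and K: "K \<in> \<T>" "x \<in> K"
    and A: "\<And>y. y \<in> K \<Longrightarrow> u y = A *v y + \<beta>"
    and g: "\<And>v. v extreme_point_of K \<Longrightarrow> g \<bullet> v + c = (A *v v) \<bullet> v"
  shows "gfem_function \<T> h u x = ((A *v x) \<bullet> x - (g \<bullet> x + c)) / h"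
proof -
  let ?a = "x v* A - g - \<beta>" and ?b = "\<beta> \<bullet> x - c"
  have adj: "(x v* A) \<bullet> y = (A *v y) \<bullet> x" for y
    by (metis dot_lmul_matrix inner_commute)
  have "u v \<bullet> (x - v) = ?a \<bullet> v + ?b" if v: "v extreme_point_of K" for v
  proof -
    have "v \<in> K" using v by (simp add: extreme_point_of_def)
    then show ?thesis
      using g[OF v] by (simp add: A adj inner_diff_left inner_diff_right inner_add_left algebra_simps)
  qed
  then have "(\<Sum>v\<in>mesh_vertices \<T>. (u v \<bullet> (x - v)) * hat \<T> v x) = ?a \<bullet> x + ?b"
    by (rule nodal_sum_on_simplex[OF T K])
  then show ?thesis
    by (simp add: gfem_function_eq_sum[OF T u] adj inner_diff_left)
qed

lemma partial_deriv_interior: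
  fixes F :: "real^'d \<Rightarrow> real"
  assumes "x \<in> interior K" and "\<And>y. y \<in> K \<Longrightarrow> f y = F y"
    and "(F has_derivative (\<lambda>v. G \<bullet> v)) (at x)"
  shows "partial_deriv j f x = G $ j"
proof -
  have f: "(f has_derivative (\<lambda>v. G \<bullet> v)) (at (x + 0 *\<^sub>R axis j 1))"
    using has_derivative_transform_within_open[OF assms(3) open_interior assms(1), of f]
      assms(2) interior_subset by fastforce
  have line: "((\<lambda>t. x + t *\<^sub>R axis j 1) has_derivative (\<lambda>t. t *\<^sub>R axis j 1)) (at (0::real))"
    by (auto intro!: derivative_eq_intros)
  have "((\<lambda>t. f (x + t *\<^sub>R axis j 1)) has_derivative (\<lambda>t. G \<bullet> (t *\<^sub>R axis j 1))) (at 0)"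
    by (rule has_derivative_compose[OF line f])
  moreover have "(\<lambda>t. G \<bullet> (t *\<^sub>R axis j 1)) = (*) (G $ j)"
    by (simp add: fun_eq_iff inner_axis)
  ultimately have "((\<lambda>t. f (x + t *\<^sub>R axis j 1)) has_field_derivative G $ j) (at 0)"
    by (simp only: has_field_derivative_def)
  then show ?thesis unfolding partial_deriv_def by (rule DERIV_imp_deriv)
qed

lemma strain_interior:
  fixes u :: "real^'d \<Rightarrow> real^'d"
  assumes "x \<in> interior K" and "\<And>y. y \<in> K \<Longrightarrow> u y = A *v y + \<beta>"
  shows "strain u x = (1/2) *\<^sub>R (A + transpose A)"
proof -
  have "partial_deriv j (\<lambda>y. u y $ i) x = A $ i $ j" for i j
  proof (rule partial_deriv_interior[OF assms(1)])
    show "u y $ i = A $ i \<bullet> y + \<beta> $ i" if "y \<in> K" for y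
      using that by (simp add: assms(2) matrix_vector_mul_component)
    show "((\<lambda>y. A $ i \<bullet> y + \<beta> $ i) has_derivative (\<bullet>) (A $ i)) (at x)"
      by (auto intro!: derivative_eq_intros)
  qed
  then show ?thesis by (simp add: strain_def vec_eq_iff transpose_def)
qed

lemma grad_gfem_interior:
  fixes u :: "real^'d \<Rightarrow> real^'d"
  assumes T: "triangulation \<T>" and u: "u \<in> V1_vec \<T>" and K: "K \<in> \<T>" "x \<in> interior K"
    and A: "\<And>y. y \<in> K \<Longrightarrow> u y = A *v y + \<beta>"
    and g: "\<And>v. v extreme_point_of K \<Longrightarrow> g \<bullet> v + c = (A *v v) \<bullet> v"
  shows "grad (gfem_function \<T> h u) x = (1/h) *\<^sub>R ((A + transpose A) *v x - g)"
proof -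
  let ?F = "\<lambda>x. ((A *v x) \<bullet> x - (g \<bullet> x + c)) / h"
  let ?G = "(1/h) *\<^sub>R ((A + transpose A) *v x - g)"
  have lin: "((*v) A has_derivative (*v) A) (at x)"
    by (rule bounded_linear_imp_has_derivative) (rule matrix_vector_mul_bounded_linear)
  have "(?F has_derivative (\<lambda>v. ((A *v x) \<bullet> v + (A *v v) \<bullet> x - g \<bullet> v) / h)) (at x)"
    by (auto intro!: derivative_eq_intros lin simp: divide_inverse)
  moreover have "((A *v x) \<bullet> v + (A *v v) \<bullet> x - g \<bullet> v) / h = ?G \<bullet> v" for v
    by (simp add: dot_lmul_matrix inner_commute[of "A *v v"] matrix_vector_mult_add_rdistrib
        inner_diff_left inner_add_left)
  ultimately have "(?F has_derivative (\<lambda>v. ?G \<bullet> v)) (at x)" by simp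
  moreover have "gfem_function \<T> h u y = ?F y" if "y \<in> K" for y
    by (rule gfem_function_on_simplex[OF T u K(1) that A g])
  ultimately have "partial_deriv j (gfem_function \<T> h u) x = ?G $ j" for j
    using partial_deriv_interior[OF K(2), of "gfem_function \<T> h u" ?F ?G] by blast
  then show ?thesis by (simp add: grad_def vec_eq_iff)
qed

text \<open>On each simplex the strain is a constant symmetric matrix \<open>E\<close>, and \<open>Ax \<bullet> x = Ex \<bullet> x\<close>: the
  skew-symmetric part of the gradient of \<open>u\<close> is invisible to both sides of the estimate.\<close>

lemma strain_and_gfem_gradient_on_simplex:
  fixes u :: "real^'d \<Rightarrow> real^'d"
  assumes T: "triangulation \<T>" and u: "u \<in> V1_vec \<T>" and K: "K \<in> \<T>"
  obtains E g c where "transpose E = E"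
    and "\<And>v. v extreme_point_of K \<Longrightarrow> g \<bullet> v + c = (E *v v) \<bullet> v"
    and "\<And>x. x \<in> interior K \<Longrightarrow> strain u x = E"
    and "\<And>x. x \<in> interior K \<Longrightarrow>
           grad (gfem_function \<T> h u) x = (1/h) *\<^sub>R (2 *\<^sub>R (E *v x) - g)"
proof -
  obtain A \<beta> where A: "\<And>x. x \<in> K \<Longrightarrow> u x = A *v x + \<beta>"
    using V1_vec_on_simplex[OF u K] by blast
  obtain n where "n simplex K" using triangulation_simplexD(1)[OF T K] by blast
  then obtain g c where g: "\<And>v. v extreme_point_of K \<Longrightarrow> g \<bullet> v + c = (A *v v) \<bullet> v"
    by (rule simplex_affine_interpolation[where g = "\<lambda>v. (A *v v) \<bullet> v"]) blast
  let ?E = "(1/2) *\<^sub>R (A + transpose A)"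
  have E: "?E *v x = (1/2) *\<^sub>R ((A + transpose A) *v x)" for x
    by (simp add: scaleR_matrix_vector_assoc)
  show ?thesis
  proof (rule that)
    show "transpose ?E = ?E" by (simp add: vec_eq_iff transpose_def)
    show "g \<bullet> v + c = (?E *v v) \<bullet> v" if "v extreme_point_of K" for v
    proof -
      have "(transpose A *v v) \<bullet> v = (A *v v) \<bullet> v"
        by (metis dot_lmul_matrix inner_commute transpose_matrix_vector)
      then show ?thesis
        using g[OF that] by (simp add: E matrix_vector_mult_add_rdistrib inner_add_left del: transpose_matrix_vector)
    qed
    show "strain u x = ?E" if "x \<in> interior K" for x
      by (rule strain_interior[OF that A])
    show "grad (gfem_function \<T> h u) x = (1/h) *\<^sub>R (2 *\<^sub>R (?E *v x) - g)" if "x \<in> interior K" for x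
      using grad_gfem_interior[OF T u K that A g] by (simp add: E)
  qed
qed

section \<open>Estimates on one simplex\<close>

lemma norm_matrix_vector_le:
  fixes E :: "real^'n^'m"
  shows "norm (E *v x) \<le> norm E * norm x"
proof -
  have "norm (E *v x) \<le> L2_set (\<lambda>i. norm (E $ i) * norm x) UNIV"
    unfolding norm_vec_def[of "E *v x"]
    by (rule L2_set_mono) (auto simp: matrix_vector_mul_component Cauchy_Schwarz_ineq2)
  then show ?thesis by (simp add: norm_vec_def[of E] L2_set_left_distrib)
qed

text \<open>The largest increment of \<open>w \<bullet> p\<close> over the convex hull of \<open>V\<close> is already bounded by the increments
  between points of \<open>V\<close>, and the ball contains segments of every length below \<open>2r\<close> in the direction
  of \<open>w\<close>.\<close>

lemma norm_le_by_vertex_differences: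
  fixes w :: "'a::euclidean_space"
  assumes ball: "ball z r \<subseteq> convex hull V"
    and V: "\<And>p q. p \<in> V \<Longrightarrow> q \<in> V \<Longrightarrow> w \<bullet> (p - q) \<le> M"
    and "0 < r"
  shows "2 * r * norm w \<le> M"
proof -
  have hull: "w \<bullet> (p - q) \<le> M" if "p \<in> convex hull V" "q \<in> convex hull V" for p q
  proof -
    have "convex hull V \<subseteq> {p. w \<bullet> p \<le> M + w \<bullet> q'}" if "q' \<in> V" for q'
      by (rule hull_minimal)
        (use V that in \<open>auto simp: convex_halfspace_le inner_diff_right algebra_simps\<close>)
    then have "convex hull V \<subseteq> {q. w \<bullet> q \<ge> w \<bullet> p - M}"
      using that(1)
      by (intro hull_minimal convex_halfspace_ge) (fastforce simp: algebra_simps)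
    then show ?thesis using that(2) by (auto simp: inner_diff_right algebra_simps)
  qed
  have s: "2 * s * norm w \<le> M" if "0 < s" "s < r" for s
  proof (cases "w = 0")
    case True
    have "z \<in> convex hull V" using ball \<open>0 < r\<close> by auto
    then show ?thesis using hull[of z z] True by simp
  next
    case False
    let ?e = "s *\<^sub>R sgn w"
    have "norm ?e = s" using False that by (simp add: norm_sgn)
    then have "z + ?e \<in> ball z r" "z - ?e \<in> ball z r" using that by (auto simp: dist_norm)
    then have "w \<bullet> ((z + ?e) - (z - ?e)) \<le> M" using ball hull by blast
    moreover have "w \<bullet> ((z + ?e) - (z - ?e)) = 2 * s * norm w"
    proof -
      have "(z + ?e) - (z - ?e) = (2 * s) *\<^sub>R sgn w" by (simp add: scaleR_2[symmetric])
      moreover have "w \<bullet> sgn w = norm w"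
        using False by (simp add: sgn_div_norm power2_norm_eq_inner[symmetric] power2_eq_square)
      ultimately show ?thesis by simp
    qed
    ultimately show ?thesis by simp
  qed
  show ?thesis
  proof (rule field_le_mult_one_interval)
    fix t :: real assume "0 < t" "t < 1"
    then show "t * (2 * r * norm w) \<le> M"
      using s[of "t * r"] \<open>0 < r\<close> by (simp add: mult_ac)
  qed
qed

text \<open>In the direction \<open>p - q\<close> of an edge, the derivative at \<open>x\<close> of the interpolation error of \<open>Ex \<bullet> x\<close> is
  \<open>E (p - q) \<bullet> (2x - p - q)\<close>, which is quadratic in the diameter.\<close>

lemma interpolation_error_gradient_le:
  fixes E :: "real^'d^'d"
  assumes K: "compact K" "convex K" and ball: "ball z r \<subseteq> K" and r: "0 < r"
    and sym: "transpose E = E"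
    and g: "\<And>v. v extreme_point_of K \<Longrightarrow> g \<bullet> v + c = (E *v v) \<bullet> v"
    and x: "x \<in> K"
  shows "r * norm (2 *\<^sub>R (E *v x) - g) \<le> norm E * (diameter K)\<^sup>2"
proof -
  let ?V = "{v. v extreme_point_of K}" and ?w = "2 *\<^sub>R (E *v x) - g" and ?D = "diameter K"
  have dist: "norm (p - q) \<le> ?D" if "p \<in> K" "q \<in> K" for p q
    using diameter_bounded_bound[OF compact_imp_bounded[OF K(1)] that] by (simp add: dist_norm)
  have adj: "(E *v p) \<bullet> q = (E *v q) \<bullet> p" for p q
    using dot_lmul_matrix[of p E q] sym by (metis inner_commute transpose_matrix_vector)
  have "?w \<bullet> (p - q) \<le> 2 * (norm E * ?D\<^sup>2)" if "p \<in> ?V" "q \<in> ?V" for p q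
  proof -
    have pq: "p \<in> K" "q \<in> K" using that by (auto simp: extreme_point_of_def)
    have "g \<bullet> p - g \<bullet> q = (E *v p) \<bullet> p - (E *v q) \<bullet> q"
      using g[of p] g[of q] that by simp
    then have "?w \<bullet> (p - q) = (E *v (p - q)) \<bullet> ((x - p) + (x - q))"
      using adj[of x p] adj[of x q] adj[of p q]
      by (simp only: inner_diff_left inner_diff_right inner_add_right inner_scaleR_left
          matrix_vector_mult_diff_distrib)
    also have "\<dots> \<le> norm (E *v (p - q)) * norm ((x - p) + (x - q))"
      by (rule norm_cauchy_schwarz)
    also have "\<dots> \<le> (norm E * ?D) * (?D + ?D)"
    proof (rule mult_mono)
      show "norm (E *v (p - q)) \<le> norm E * ?D"
        by (rule order_trans[OF norm_matrix_vector_le mult_left_mono]) (auto intro: dist pq)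
      show "norm ((x - p) + (x - q)) \<le> ?D + ?D"
        by (rule norm_triangle_mono) (auto intro: dist pq x)
      show "0 \<le> norm E * ?D" using dist[OF x x] by simp
    qed simp
    finally show ?thesis by (simp add: power2_eq_square algebra_simps)
  qed
  then have "2 * r * norm ?w \<le> 2 * (norm E * ?D\<^sup>2)"
    using norm_le_by_vertex_differences[of z r ?V ?w] ball r Krein_Milman_Minkowski[OF K] by simp
  then show ?thesis by simp
qed

text \<open>Chebyshev's inequality: for \<open>x \<in> B\<close> the norm of \<open>f\<close> is at least \<open>\<delta>\<close> at \<open>x\<close> or at \<open>x + t\<close>, so
  the points of \<open>K\<close> where \<open>\<bar>f\<bar> \<ge> \<delta>\<close> form a set with at least half the measure of \<open>B\<close>.\<close>

lemma square_integral_ge_by_increments: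
  fixes f :: "'a::euclidean_space \<Rightarrow> 'b::euclidean_space"
  assumes K: "compact K" and f: "continuous_on K f"
    and B: "B \<in> lmeasurable" "B \<subseteq> K" "(+) t ` B \<subseteq> K"
    and incr: "\<And>x. x \<in> B \<Longrightarrow> 2 * \<delta> \<le> norm (f (x + t) - f x)" and "0 \<le> \<delta>"
    and int: "(\<lambda>x. (norm (f x))\<^sup>2) integrable_on K"
  shows "\<delta>\<^sup>2 * measure lebesgue B \<le> 2 * integral K (\<lambda>x. (norm (f x))\<^sup>2)"
proof -
  define S where "S = {x \<in> K. \<delta> \<le> norm (f x)}"
  have "closed S"
    unfolding S_def
    using continuous_on_closed_Collect_le[OF continuous_on_const continuous_on_norm[OF f]]
      compact_imp_closed[OF K] by auto
  then have "compact S"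
    using compact_Int_closed[OF K, of S] by (simp add: S_def Int_absorb1 subset_iff Int_def conj_commute)
  then have S: "S \<in> lmeasurable" by (rule lmeasurable_compact)
  have "B \<subseteq> S \<union> (+) (- t) ` S"
  proof
    fix x assume x: "x \<in> B"
    have "norm (f (x + t) - f x) \<le> norm (f (x + t)) + norm (f x)" by (rule norm_triangle_ineq4)
    with incr[OF x] have "\<delta> \<le> norm (f x) \<or> \<delta> \<le> norm (f (x + t))" by linarith
    moreover have "x \<in> K" "x + t \<in> K" using B x by (auto simp: add.commute image_subset_iff)
    ultimately have "x \<in> S \<or> x + t \<in> S" by (auto simp: S_def)
    then show "x \<in> S \<union> (+) (- t) ` S" by (auto simp: image_iff algebra_simps intro: bexI[of _ "x + t"])
  qed
  then have "measure lebesgue B \<le> measure lebesgue (S \<union> (+) (- t) ` S)"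
    using S B by (intro measure_mono_fmeasurable fmeasurable.Un measurable_translation)
      (auto intro: fmeasurableD)
  also have "\<dots> \<le> measure lebesgue S + measure lebesgue ((+) (- t) ` S)"
    using S by (intro measure_Un_le fmeasurableD measurable_translation)
  finally have "measure lebesgue B \<le> 2 * measure lebesgue S"
    by (simp only: measure_translation)
  then have "\<delta>\<^sup>2 * measure lebesgue B \<le> 2 * (\<delta>\<^sup>2 * measure lebesgue S)"
    using mult_left_mono[of _ _ "\<delta>\<^sup>2"] by fastforce
  also have "\<delta>\<^sup>2 * measure lebesgue S = integral S (\<lambda>_. \<delta>\<^sup>2)"
    using lmeasure_integral[OF S] integral_mult_right[of S "\<delta>\<^sup>2" "\<lambda>_. 1"] by simp
  also have "\<dots> \<le> integral K (\<lambda>x. (norm (f x))\<^sup>2)"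
  proof -
    have "integral S (\<lambda>_. \<delta>\<^sup>2) = integral K (\<lambda>x. if x \<in> S then \<delta>\<^sup>2 else 0)"
      by (subst integral_restrict_Int) (simp add: S_def Int_def conj_commute)
    also have "\<dots> \<le> integral K (\<lambda>x. (norm (f x))\<^sup>2)"
    proof (rule integral_le)
      have "(\<lambda>_. \<delta>\<^sup>2) integrable_on S \<inter> K"
        using integrable_on_const[OF S] by (simp add: S_def Int_def conj_commute)
      then show "(\<lambda>x. if x \<in> S then \<delta>\<^sup>2 else 0) integrable_on K"
        by (simp add: integrable_restrict_Int)
    qed (use int \<open>0 \<le> \<delta>\<close> in \<open>auto simp: S_def power_mono\<close>)
    finally show ?thesis .
  qed
  finally show ?thesis by simp
qed

text \<open>Along a unit vector \<open>e\<close> the map \<open>x \<mapsto> 2Ex - g\<close> grows by \<open>2rEe\<close> over a distance \<open>r\<close>, whatever the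
  constant \<open>g\<close> is. Some coordinate direction has \<open>\<bar>Ee\<bar>\<^sup>2\<close> at least the mean \<open>\<bar>E\<bar>\<^sup>2/d\<close>, and two
  balls of radius \<open>r/2\<close> whose centres differ by \<open>re\<close> fit into the inball.\<close>

lemma affine_map_square_integral_ge:
  fixes E :: "real^'d^'d"
  assumes K: "compact K" and ball: "ball z r \<subseteq> K" and r: "0 < r" and sym: "transpose E = E"
    and int: "(\<lambda>x. (norm (2 *\<^sub>R (E *v x) - g))\<^sup>2) integrable_on K"
  shows "(norm E)\<^sup>2 * r\<^sup>2 * measure lebesgue (ball z (r / 2))
    \<le> 2 * real CARD('d) * integral K (\<lambda>x. (norm (2 *\<^sub>R (E *v x) - g))\<^sup>2)"
proof -
  let ?w = "\<lambda>x. 2 *\<^sub>R (E *v x) - g" and ?d = "real CARD('d)"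
  have nE: "(norm E)\<^sup>2 = (\<Sum>j\<in>UNIV. (norm (E $ j))\<^sup>2)"
    by (simp add: norm_vec_def[of E] L2_set_def sum_nonneg)
  obtain j where j: "(norm E)\<^sup>2 \<le> ?d * (norm (E $ j))\<^sup>2"
  proof (rule ccontr)
    assume "\<not> thesis"
    then have "?d * (norm (E $ j))\<^sup>2 < (norm E)\<^sup>2" for j using that by (meson not_le)
    then have "(\<Sum>j\<in>(UNIV::'d set). ?d * (norm (E $ j))\<^sup>2) < (\<Sum>j\<in>(UNIV::'d set). (norm E)\<^sup>2)"
      by (intro sum_strict_mono) auto
    then show False by (simp add: sum_distrib_left[symmetric] nE)
  qed
  let ?e = "axis j 1 :: real^'d"
  have Ee: "E *v ?e = E $ j"
    using sym by (metis matrix_vector_mult_basis row_def column_transpose vec_lambda_eta)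
  have e: "norm ?e = 1" by (simp add: norm_axis_1)
  let ?B = "ball (z - (r / 2) *\<^sub>R ?e) (r / 2)"
  have "(r * norm (E $ j))\<^sup>2 * measure lebesgue ?B \<le> 2 * integral K (\<lambda>x. (norm (?w x))\<^sup>2)"
  proof (rule square_integral_ge_by_increments[where t = "r *\<^sub>R ?e", OF K])
    show "continuous_on K ?w" by (intro continuous_intros matrix_vector_mult_linear_continuous_on)
    show "?B \<in> lmeasurable" by (rule lmeasurable_ball)
    have "?B \<subseteq> ball z r"
      by (rule ball_subset_ball_iff[THEN iffD2]) (use r e in \<open>simp add: dist_norm\<close>)
    then show "?B \<subseteq> K" using ball by blast
    have "(+) (r *\<^sub>R ?e) ` ?B = ball (z + (r / 2) *\<^sub>R ?e) (r / 2)"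
    proof -
      have "r *\<^sub>R ?e + (z - (r / 2) *\<^sub>R ?e) = z + (r / 2) *\<^sub>R ?e"
        by (simp add: vec_eq_iff field_simps)
      then show ?thesis by (simp only: ball_translation[symmetric])
    qed
    also have "\<dots> \<subseteq> ball z r"
      by (rule ball_subset_ball_iff[THEN iffD2]) (use r e in \<open>simp add: dist_norm\<close>)
    finally show "(+) (r *\<^sub>R ?e) ` ?B \<subseteq> K" using ball by blast
    show "2 * (r * norm (E $ j)) \<le> norm (?w (x + r *\<^sub>R ?e) - ?w x)" for x
    proof -
      have "?w (x + r *\<^sub>R ?e) - ?w x = (2 * r) *\<^sub>R (E $ j)"
        by (simp add: matrix_vector_right_distrib matrix_vector_mult_scaleR Ee algebra_simps)
      then show ?thesis using r by simp
    qed
    show "0 \<le> r * norm (E $ j)" using r by simp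
  qed (rule int)
  moreover have "measure lebesgue ?B = measure lebesgue (ball z (r / 2))"
    using r by (simp add: content_ball)
  ultimately have "?d * ((r * norm (E $ j))\<^sup>2 * measure lebesgue (ball z (r / 2)))
      \<le> ?d * (2 * integral K (\<lambda>x. (norm (?w x))\<^sup>2))"
    by (intro mult_left_mono) auto
  moreover have "(norm E)\<^sup>2 * (r\<^sup>2 * measure lebesgue (ball z (r / 2)))
      \<le> ?d * (norm (E $ j))\<^sup>2 * (r\<^sup>2 * measure lebesgue (ball z (r / 2)))"
    by (intro mult_right_mono j) auto
  ultimately show ?thesis by (simp only: power_mult_distrib mult_ac)
qed

text \<open>The set lies in a ball of radius \<open>diameter K\<close>, which is at most \<open>2/\<kappa>\<close> times the radius \<open>r/2\<close>, and
  volumes of balls scale with the power \<open>DIM('a)\<close> of the radius.\<close>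

lemma measure_le_by_inball:
  fixes K :: "'a::euclidean_space set"
  assumes K: "compact K" and ball: "ball z r \<subseteq> K" and r: "0 < r"
    and \<kappa>: "0 < \<kappa>" "\<kappa> * diameter K \<le> r"
  shows "(\<kappa> / 2) ^ DIM('a) * measure lebesgue K \<le> measure lebesgue (ball z (r / 2))"
proof -
  let ?D = "diameter K"
  have z: "z \<in> K" using ball r by auto
  have D: "0 \<le> ?D" using diameter_ge_0 compact_imp_bounded[OF K] by blast
  have "K \<subseteq> cball z ?D"
    using diameter_bounded_bound[OF compact_imp_bounded[OF K] z] by auto
  then have "measure lebesgue K \<le> measure lebesgue (cball z ?D)"
    using K by (intro measure_mono_fmeasurable) (auto intro: lmeasurable_compact fmeasurableD)
  then have "(\<kappa> / 2) ^ DIM('a) * measure lebesgue K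
      \<le> (\<kappa> / 2) ^ DIM('a) * (unit_ball_vol (DIM('a)) * ?D ^ DIM('a))"
    using \<kappa> D by (intro mult_left_mono) (auto simp: content_cball)
  also have "\<dots> = unit_ball_vol (DIM('a)) * (\<kappa> * ?D / 2) ^ DIM('a)"
    by (simp add: power_mult_distrib power_divide)
  also have "\<dots> \<le> unit_ball_vol (DIM('a)) * (r / 2) ^ DIM('a)"
    using \<kappa> D by (intro mult_left_mono power_mono) auto
  also have "\<dots> = measure lebesgue (ball z (r / 2))" using r by (simp add: content_ball)
  finally show ?thesis .
qed

lemma integrable_continuous_on_compact:
  fixes f :: "'a::euclidean_space \<Rightarrow> real"
  assumes "compact K" "continuous_on UNIV f"
  shows "f integrable_on K"
proof -
  obtain a b where "K \<subseteq> cbox a b"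
    using bounded_subset_cbox_symmetric[OF compact_imp_bounded[OF assms(1)]] by blast
  moreover have "f absolutely_integrable_on cbox a b"
    by (rule absolutely_integrable_continuous) (use assms(2) continuous_on_subset in blast)
  ultimately have "f absolutely_integrable_on K"
    using set_integrable_subset assms(1) lmeasurable_compact by blast
  then show ?thesis by (rule set_lebesgue_integral_eq_integral)
qed

lemma has_integral_const_lmeasurable:
  fixes c :: real
  assumes "S \<in> lmeasurable"
  shows "((\<lambda>_. c) has_integral c * measure lebesgue S) S"
proof -
  have "((\<lambda>_. 1::real) has_integral measure lebesgue S) S"
    using assms lmeasure_integral[OF assms] lmeasurable_iff_integrable_on by (metis has_integral_iff)
  from has_integral_mult_right[OF this, of c] show ?thesis by simp
qed

text \<open>Shape regularity enters through \<open>\<kappa>\<close>, and the comparability of \<open>h\<close> with the diameter through \<open>a\<close>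
  below and \<open>b\<close> above. Neither constant depends on \<open>K\<close>, \<open>h\<close> or \<open>E\<close>, so the estimates can be summed
  over the mesh.\<close>

lemma simplex_energy_equivalence:
  fixes E :: "real^'d^'d"
  assumes K: "compact K" "convex K" and ball: "ball z r \<subseteq> K"
    and \<kappa>: "0 < \<kappa>" "\<kappa> * diameter K \<le> r"
    and ab: "0 < a" "0 < h" "a * h \<le> diameter K" "diameter K \<le> b * h"
    and sym: "transpose E = E"
    and g: "\<And>v. v extreme_point_of K \<Longrightarrow> g \<bullet> v + c = (E *v v) \<bullet> v"
  defines "S \<equiv> (norm E)\<^sup>2 * measure lebesgue K"
    and "F \<equiv> \<lambda>x. (norm ((1/h) *\<^sub>R (2 *\<^sub>R (E *v x) - g)))\<^sup>2"
  shows "((\<lambda>_. (norm E)\<^sup>2) has_integral S) K"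
    and "(F has_integral integral K F) K"
    and "(\<kappa> / 2) ^ CARD('d) * (\<kappa> * a)\<^sup>2 / (2 * real CARD('d)) * S \<le> integral K F"
    and "integral K F \<le> (b / \<kappa>)\<^sup>2 * S"
proof -
  let ?w = "\<lambda>x. 2 *\<^sub>R (E *v x) - g" and ?D = "diameter K" and ?d = "real CARD('d)"
  let ?q = "(\<kappa> / 2) ^ CARD('d)"
  have D: "0 < ?D" using ab by (smt (verit) mult_pos_pos)
  then have r: "0 < r" using \<kappa> by (smt (verit) mult_pos_pos)
  have meas: "K \<in> lmeasurable" by (rule lmeasurable_compact[OF K(1)])
  show S: "((\<lambda>_. (norm E)\<^sup>2) has_integral S) K"
    unfolding S_def by (rule has_integral_const_lmeasurable[OF meas])
  have wint: "(\<lambda>x. (norm (?w x))\<^sup>2) integrable_on K"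
    by (intro integrable_continuous_on_compact[OF K(1)] continuous_intros
        matrix_vector_mult_linear_continuous_on)
  have F: "F x = (norm (?w x))\<^sup>2 / h\<^sup>2" for x
    unfolding F_def norm_scaleR by (simp add: power_mult_distrib power_divide)
  have Fint: "F integrable_on K"
    unfolding F using wint by (rule integrable_on_divide)
  then show "(F has_integral integral K F) K" by (rule integrable_integral)
  have IF: "integral K F = integral K (\<lambda>x. (norm (?w x))\<^sup>2) / h\<^sup>2"
    unfolding F by (rule integral_divide)
  show "?q * (\<kappa> * a)\<^sup>2 / (2 * ?d) * S \<le> integral K F"
  proof -
    have "\<kappa> * a * h \<le> r" using ab(3) \<kappa> by (smt (verit) mult.assoc mult_left_mono)
    then have "(\<kappa> * a * h)\<^sup>2 \<le> r\<^sup>2" using \<kappa> ab by (intro power_mono) auto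
    moreover have "?q * measure lebesgue K \<le> measure lebesgue (ball z (r / 2))"
      using measure_le_by_inball[OF K(1) ball r \<kappa>] by simp
    ultimately have "(norm E)\<^sup>2 * ((\<kappa> * a * h)\<^sup>2 * (?q * measure lebesgue K))
        \<le> (norm E)\<^sup>2 * (r\<^sup>2 * measure lebesgue (ball z (r / 2)))"
      using \<kappa> by (intro mult_left_mono mult_mono) auto
    also have "\<dots> \<le> 2 * ?d * integral K (\<lambda>x. (norm (?w x))\<^sup>2)"
      using affine_map_square_integral_ge[OF K(1) ball r sym wint] by (simp add: mult.assoc)
    finally have "?q * (\<kappa> * a)\<^sup>2 * S * h\<^sup>2 \<le> 2 * ?d * integral K (\<lambda>x. (norm (?w x))\<^sup>2)"
      by (simp add: S_def power_mult_distrib mult_ac)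
    then show ?thesis
      using ab(2) by (simp add: IF divide_simps mult_ac)
  qed
  show "integral K F \<le> (b / \<kappa>)\<^sup>2 * S"
  proof (rule has_integral_le[OF integrable_integral[OF Fint] has_integral_mult_right[OF S]])
    fix x assume x: "x \<in> K"
    have "\<kappa> * ?D * norm (?w x) \<le> r * norm (?w x)"
      using \<kappa> by (intro mult_right_mono) auto
    also have "\<dots> \<le> norm E * ?D\<^sup>2"
      by (rule interpolation_error_gradient_le[OF K ball r sym g x])
    finally have "?D * (\<kappa> * norm (?w x)) \<le> ?D * (norm E * ?D)"
      by (simp add: power2_eq_square mult_ac)
    then have "\<kappa> * norm (?w x) \<le> norm E * ?D" using D by simp
    also have "\<dots> \<le> norm E * (b * h)" using ab by (intro mult_left_mono) auto
    finally have "norm (?w x) / h \<le> b / \<kappa> * norm E"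
      using \<kappa> ab by (simp add: divide_simps mult_ac)
    then have "(norm (?w x) / h)\<^sup>2 \<le> (b / \<kappa> * norm E)\<^sup>2"
      using ab(2) by (intro power_mono) auto
    then show "F x \<le> (b / \<kappa>)\<^sup>2 * (norm E)\<^sup>2"
      by (simp only: F power_mult_distrib power_divide)
  qed
qed

section \<open>Assembling the simplices\<close>

lemma polygonal_domain_negligible_frontier:
  fixes \<Omega> :: "(real^'d) set"
  assumes "polygonal_domain \<Omega>"
  shows "negligible (frontier \<Omega>)"
proof -
  obtain \<F> where F: "finite \<F>" "\<And>F. F \<in> \<F> \<Longrightarrow> polytope F \<and> aff_dim F = int CARD('d) - 1"
      "frontier \<Omega> = \<Union>\<F>"
    using assms by (auto simp: polygonal_domain_def)
  have "negligible F" if "F \<in> \<F>" for F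
    using F(2)[OF that] aff_dim_nonempty_interior[of F] polytope_imp_convex[of F]
    by (auto simp: negligible_convex_interior)
  then show ?thesis using F by (simp add: negligible_Union)
qed

lemma triangulation_of_negligible_overlap:
  fixes \<T> :: "(real^'d) set set"
  assumes "triangulation_of \<Omega> \<T>" "K \<in> \<T>" "K' \<in> \<T>" "K \<noteq> K'"
  shows "negligible (K \<inter> K')"
proof (rule ccontr)
  assume neg: "\<not> negligible (K \<inter> K')"
  have T: "triangulation \<T>" using assms by (simp add: triangulation_of_def)
  have cvx: "convex K" "convex K'" using triangulation_simplexD[OF T] assms by blast+
  have face: "K \<inter> K' face_of K" "K \<inter> K' face_of K'"
    using triangulation_faceD[OF T] assms by blast+
  have dim: "aff_dim K = int CARD('d)" "aff_dim K' = int CARD('d)"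
    using assms by (auto simp: triangulation_of_def intro: aff_dim_simplex)
  have "interior (K \<inter> K') \<noteq> {}"
    using neg cvx by (simp add: negligible_convex_interior convex_Int del: interior_Int)
  then have "aff_dim (K \<inter> K') = int CARD('d)" using aff_dim_nonempty_interior by fastforce
  then have "K \<inter> K' = K" "K \<inter> K' = K'"
    using face_of_aff_dim_lt[OF cvx(1) face(1)] face_of_aff_dim_lt[OF cvx(2) face(2)] dim by auto
  then show False using assms(4) by simp
qed

text \<open>The frontier of \<open>\<Omega>\<close> is a null set, so the open domain and its triangulated closure carry the same
  integrals even when cracks separate them.\<close>

lemma L2_norm_elementwise:
  fixes \<Omega> :: "(real^'d) set" and f :: "real^'d \<Rightarrow> 'b::real_normed_vector"
  assumes \<Omega>: "polygonal_domain \<Omega>" and T: "triangulation_of \<Omega> \<T>"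
    and f: "\<And>K. K \<in> \<T> \<Longrightarrow> (F K has_integral I K) K"
    and eq: "\<And>K x. K \<in> \<T> \<Longrightarrow> x \<in> interior K \<Longrightarrow> (norm (f x))\<^sup>2 = F K x"
  shows "L2_norm \<Omega> f = sqrt (\<Sum>K\<in>\<T>. I K)"
proof -
  let ?q = "\<lambda>x. (norm (f x))\<^sup>2"
  have "(?q has_integral I K) K" if K: "K \<in> \<T>" for K
  proof (rule has_integral_spike[OF _ _ f[OF K]])
    have "convex K" using T K triangulation_simplexD(3) by (auto simp: triangulation_of_def)
    then show "negligible (frontier K)" by (rule negligible_convex_frontier)
    show "?q x = F K x" if "x \<in> K - frontier K" for x
      using that eq[OF K] closure_subset by (auto simp: frontier_def)
  qed
  then have "(?q has_integral (\<Sum>K\<in>\<T>. I K)) (\<Union>\<T>)"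
    using T triangulation_of_negligible_overlap[OF T]
    by (intro has_integral_Union) (auto simp: triangulation_of_def triangulation_def pairwise_def)
  then have "(?q has_integral (\<Sum>K\<in>\<T>. I K)) (closure \<Omega>)"
    using T by (simp add: triangulation_of_def)
  moreover have "negligible {x \<in> closure \<Omega> - \<Omega>. ?q x \<noteq> 0}"
  proof (rule negligible_subset[OF polygonal_domain_negligible_frontier[OF \<Omega>]])
    show "{x \<in> closure \<Omega> - \<Omega>. ?q x \<noteq> 0} \<subseteq> frontier \<Omega>"
      using interior_subset by (auto simp: frontier_def)
  qed
  moreover have "{x \<in> \<Omega> - closure \<Omega>. ?q x \<noteq> 0} = {}" using closure_subset by auto
  ultimately have q: "(?q has_integral (\<Sum>K\<in>\<T>. I K)) \<Omega>"
    using has_integral_spike_set_eq[of "closure \<Omega>" \<Omega> ?q] negligible_empty by metis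
  then have "?q absolutely_integrable_on \<Omega>"
    by (intro nonnegative_absolutely_integrable_1) auto
  then have "(LINT x:\<Omega>|lebesgue. ?q x) = integral \<Omega> ?q"
    by (rule set_lebesgue_integral_eq_integral)
  then show ?thesis using integral_unique[OF q] by (simp add: L2_norm_def)
qed

theorem lemma3p3:
  fixes \<Omega> :: "(real^'d) set"
    and H :: "real set"
    and \<T> :: "real \<Rightarrow> (real^'d) set set"
  assumes "CARD('d) = 2 \<or> CARD('d) = 3"
    and "polygonal_domain \<Omega>"
    and "\<And>h. h \<in> H \<Longrightarrow> 0 < h"
    and "\<And>h. h \<in> H \<Longrightarrow> triangulation_of \<Omega> (\<T> h)"
    and "quasi_uniform H \<T>"
  shows "\<exists>c C. 0 < c \<and> c \<le> C \<and>
    (\<forall>h\<in>H. \<forall>u\<in>V1_vec (\<T> h).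
       c * L2_norm \<Omega> (strain u) \<le> L2_norm \<Omega> (grad (gfem_function (\<T> h) h u)) \<and>
       L2_norm \<Omega> (grad (gfem_function (\<T> h) h u)) \<le> C * L2_norm \<Omega> (strain u))"
proof -
  obtain \<kappa> a b where \<kappa>: "0 < \<kappa>" and a: "0 < a" and b: "0 < b"
    and inball: "\<And>h K. h \<in> H \<Longrightarrow> K \<in> \<T> h \<Longrightarrow> \<exists>z r. \<kappa> * diameter K \<le> r \<and> ball z r \<subseteq> K"
    and diam: "\<And>h K. h \<in> H \<Longrightarrow> K \<in> \<T> h \<Longrightarrow> a * h \<le> diameter K \<and> diameter K \<le> b * h"
    using assms(5) by (auto simp: quasi_uniform_def)
  let ?q = "(\<kappa> / 2) ^ CARD('d) * (\<kappa> * a)\<^sup>2 / (2 * real CARD('d))"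
  have q: "0 < ?q" using \<kappa> a by simp
  have est: "sqrt ?q * L2_norm \<Omega> (strain u) \<le> L2_norm \<Omega> (grad (gfem_function (\<T> h) h u)) \<and>
      L2_norm \<Omega> (grad (gfem_function (\<T> h) h u)) \<le> b / \<kappa> * L2_norm \<Omega> (strain u)"
    if h: "h \<in> H" and u: "u \<in> V1_vec (\<T> h)" for h u
  proof -
    have To: "triangulation_of \<Omega> (\<T> h)" using assms(4)[OF h] .
    then have T: "triangulation (\<T> h)" by (simp add: triangulation_of_def)
    let ?u\<^sub>G = "gfem_function (\<T> h) h u"
    define data where "data K E g c \<longleftrightarrow> transpose E = E \<and>
        (\<forall>v. v extreme_point_of K \<longrightarrow> g \<bullet> v + c = (E *v v) \<bullet> v) \<and>
        (\<forall>x\<in>interior K. strain u x = E) \<and>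
        (\<forall>x\<in>interior K. grad ?u\<^sub>G x = (1/h) *\<^sub>R (2 *\<^sub>R (E *v x) - g))" for K E g c
    have "\<exists>E g c. data K E g c" if "K \<in> \<T> h" for K
      unfolding data_def
      by (rule strain_and_gfem_gradient_on_simplex[OF T u that, where h = h]) blast
    then obtain E g c where data: "\<And>K. K \<in> \<T> h \<Longrightarrow> data K (E K) (g K) (c K)" by metis
    then have sym: "\<And>K. K \<in> \<T> h \<Longrightarrow> transpose (E K) = E K"
      and g: "\<And>K v. K \<in> \<T> h \<Longrightarrow> v extreme_point_of K \<Longrightarrow> g K \<bullet> v + c K = (E K *v v) \<bullet> v"
      and strain: "\<And>K x. K \<in> \<T> h \<Longrightarrow> x \<in> interior K \<Longrightarrow> strain u x = E K"
      and grad: "\<And>K x. K \<in> \<T> h \<Longrightarrow> x \<in> interior K \<Longrightarrow>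
        grad ?u\<^sub>G x = (1/h) *\<^sub>R (2 *\<^sub>R (E K *v x) - g K)"
      by (simp_all add: data_def)
    define S where "S K = (norm (E K))\<^sup>2 * measure lebesgue K" for K
    define F where "F K x = (norm ((1/h) *\<^sub>R (2 *\<^sub>R (E K *v x) - g K)))\<^sup>2" for K x
    have K: "((\<lambda>_. (norm (E K))\<^sup>2) has_integral S K) K \<and> (F K has_integral integral K (F K)) K \<and>
        ?q * S K \<le> integral K (F K) \<and> integral K (F K) \<le> (b / \<kappa>)\<^sup>2 * S K" if K: "K \<in> \<T> h" for K
    proof -
      obtain z r where r: "\<kappa> * diameter K \<le> r" and ball: "ball z r \<subseteq> K"
        using inball[OF h K] by blast
      note equiv = simplex_energy_equivalence[OF triangulation_simplexD(2,3)[OF T K] ball \<kappa> r a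
          assms(3)[OF h] conjunct1[OF diam[OF h K]] conjunct2[OF diam[OF h K]] sym[OF K] g[OF K]]
      show ?thesis unfolding S_def F_def using equiv by blast
    qed
    have LS: "L2_norm \<Omega> (strain u) = sqrt (\<Sum>K\<in>\<T> h. S K)"
      by (rule L2_norm_elementwise[OF assms(2) To, where F = "\<lambda>K _. (norm (E K))\<^sup>2"])
        (use K strain in auto)
    have LG: "L2_norm \<Omega> (grad ?u\<^sub>G) = sqrt (\<Sum>K\<in>\<T> h. integral K (F K))"
      by (rule L2_norm_elementwise[OF assms(2) To, where F = F])
        (use K grad in \<open>auto simp: F_def\<close>)
    have "?q * (\<Sum>K\<in>\<T> h. S K) \<le> (\<Sum>K\<in>\<T> h. integral K (F K))"
      unfolding sum_distrib_left by (rule sum_mono) (use K in blast)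
    then have lower: "sqrt ?q * L2_norm \<Omega> (strain u) \<le> L2_norm \<Omega> (grad ?u\<^sub>G)"
      unfolding LS LG real_sqrt_mult[symmetric] by (rule real_sqrt_le_mono)
    have "(\<Sum>K\<in>\<T> h. integral K (F K)) \<le> (b / \<kappa>)\<^sup>2 * (\<Sum>K\<in>\<T> h. S K)"
      unfolding sum_distrib_left by (rule sum_mono) (use K in blast)
    then have "L2_norm \<Omega> (grad ?u\<^sub>G) \<le> sqrt ((b / \<kappa>)\<^sup>2 * (\<Sum>K\<in>\<T> h. S K))"
      unfolding LG by (rule real_sqrt_le_mono)
    also have "\<dots> = b / \<kappa> * L2_norm \<Omega> (strain u)"
      using b \<kappa> by (simp add: LS real_sqrt_mult)
    finally show ?thesis using lower by blast
  qed
  \<comment> \<open>The two estimates alone do not order the constants, for instance when \<open>H\<close> is empty; hence the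
      maximum.\<close>
  let ?C = "max (sqrt ?q) (b / \<kappa>)"
  have "b / \<kappa> * L2_norm \<Omega> f \<le> ?C * L2_norm \<Omega> f" for f :: "real^'d \<Rightarrow> real^'d^'d"
    by (intro mult_right_mono) (auto simp: L2_norm_def set_lebesgue_integral_def)
  then have "\<forall>h\<in>H. \<forall>u\<in>V1_vec (\<T> h).
      sqrt ?q * L2_norm \<Omega> (strain u) \<le> L2_norm \<Omega> (grad (gfem_function (\<T> h) h u)) \<and>
      L2_norm \<Omega> (grad (gfem_function (\<T> h) h u)) \<le> ?C * L2_norm \<Omega> (strain u)"
    using est order_trans by blast
  then show ?thesis using q by (intro exI[of _ "sqrt ?q"] exI[of _ ?C]) simp
qed

end
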